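(* Let $r\geq 0$ and $s>0$ be integers, let $n=p^m$ be a prime power ($p$ prime, $m\geq 1$), and let $\chi_1,\ldots,\chi_s$ be Dirichlet characters modulo $n$ with conductors $p^{t_1},\ldots,p^{t_s}$ ($0\le t_i\le m$). Let $u=\max\{t_1,\ldots,t_s\}$ and \[ S=\sum_{\substack{a_1,\ldots,a_s\in\mathbb{Z}_n^\ast\\ b_1,\ldots,b_r\in\mathbb{Z}_n}}\gcd(a_1-1,\ldots,a_s-1,b_1,\ldots,b_r,n)\,\chi_1(a_1)\cdots\chi_s(a_s). \] Then $S=\varphi(p^m)\,\sigma_{s+r-1}(p^{m-u})$ if $u>0$, and $S=\varphi(p^m)\left(\varphi(p^m)^{s-1}p^{mr}+\sigma_{s+r-1}(p^m)-p^{m(s+r-1)}\right)$ if $u=0$.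
   Context: $\mathbb{Z}_n=\mathbb{Z}/n\mathbb{Z}$ and $\mathbb{Z}_n^\ast$ is its group of units; gcds are computed with integer representatives. $\varphi$ is Euler's totient function and $\sigma_k(N)=\sum_{e\mid N}e^k$. *)

theory Defs
  imports Complex_Main "HOL-Library.FuncSet" "HOL-Number_Theory.Residues"
begin

text \<open>
  As usual, a character of the unit group modulo \<open>n\<close> is regarded as an \<open>n\<close>-periodic function
  on the integers that vanishes exactly at the integers not coprime to \<open>n\<close>.  The condition
  \<open>\<chi> 1 = 1\<close> follows from multiplicativity and \<open>\<chi> 1 \<noteq> 0\<close>.
\<close>

definition dirichlet_character :: "nat \<Rightarrow> (int \<Rightarrow> complex) \<Rightarrow> bool" where
  "dirichlet_character n \<chi> \<longleftrightarrow>
     (\<forall>a b. \<chi> (a * b) = \<chi> a * \<chi> b) \<and>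
     (\<forall>a. \<chi> (a + int n) = \<chi> a) \<and>
     (\<forall>a. \<chi> a \<noteq> 0 \<longleftrightarrow> coprime a (int n))"

text \<open>
  The least divisor \<open>d\<close> of \<open>n\<close> such that \<open>\<chi>\<close> is induced by a character modulo \<open>d\<close>.  For
  \<open>n > 0\<close> the trivial character modulo \<open>n\<close> has conductor \<open>1\<close>.
\<close>

definition conductor :: "nat \<Rightarrow> (int \<Rightarrow> complex) \<Rightarrow> nat" where
  "conductor n \<chi> =
     (LEAST d. d dvd n \<and>
        (\<exists>\<psi>. dirichlet_character d \<psi> \<and> (\<forall>a. coprime a (int n) \<longrightarrow> \<chi> a = \<psi> a)))"

definition divisor_sigma :: "nat \<Rightarrow> nat \<Rightarrow> nat" where
  "divisor_sigma k N = (\<Sum>e | e dvd N. e ^ k)"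

end

theory Submission
  imports Defs
begin

text \<open>
  Write the greatest common divisor as \<open>\<Sum>d. \<phi>(d)\<close> over its divisors.  Then \<open>S\<close> splits as a sum over
  \<open>d dvd n\<close> of \<open>\<phi>(d)\<close> times a product of sums in a single variable: each \<open>b\<^sub>i\<close> contributes the number
  \<open>n/d\<close> of multiples of \<open>d\<close>, and each \<open>a\<^sub>i\<close> contributes the sum of \<open>\<chi>\<^sub>i\<close> over the units congruent
  to \<open>1\<close> modulo \<open>d\<close>.  By orthogonality the latter is zero unless \<open>\<chi>\<^sub>i\<close> is trivial on these units, which
  for \<open>n = p\<^sup>m\<close>, \<open>d = p\<^sup>j\<close> means that the conductor of \<open>\<chi>\<^sub>i\<close> divides \<open>p\<^sup>j\<close>.  So only the \<open>j \<ge> u\<close> contribute,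
  and \<open>j = 0\<close> is exceptional because not all residues congruent to \<open>1\<close> modulo \<open>1\<close> are units.
\<close>

section \<open>Periodicity and multiplicativity of Dirichlet characters\<close>

lemma dirichlet_character_cong:
  assumes "dirichlet_character n \<chi>" "[a = b] (mod int n)"
  shows "\<chi> a = \<chi> b"
proof -
  have nat_shift: "\<chi> (x + int n * int k) = \<chi> x" for x k
  proof (induction k)
    case (Suc k)
    have "\<chi> (x + int n * int k + int n) = \<chi> (x + int n * int k)"
      using assms(1) by (simp add: dirichlet_character_def)
    with Suc show ?case by (simp add: algebra_simps)
  qed simp
  obtain l where l: "b = a + int n * l"
    using assms(2) cong_iff_lin by blast
  show ?thesis
  proof (cases "l \<ge> 0")
    case True
    then show ?thesis using nat_shift[of a "nat l"] l by simp
  next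
    case False
    \<comment> \<open>The induction covers only nonnegative multiples of the period, so here the
      shift runs from \<open>b\<close> to \<open>a\<close>.\<close>
    then have "a = b + int n * int (nat (- l))" using l by simp
    then show ?thesis using nat_shift[of b "nat (- l)"] by simp
  qed
qed

lemma dirichlet_character_1:
  assumes "dirichlet_character n \<chi>"
  shows "\<chi> 1 = 1"
proof -
  have "\<chi> 1 = \<chi> 1 * \<chi> 1" "\<chi> 1 \<noteq> 0"
    using assms unfolding dirichlet_character_def by (metis mult_1, simp)
  then show ?thesis by simp
qed

lemma dirichlet_character_mult:
  "dirichlet_character n \<chi> \<Longrightarrow> \<chi> (a * b) = \<chi> a * \<chi> b"
  by (simp add: dirichlet_character_def)

lemma dirichlet_character_eq_0_iff:
  "dirichlet_character n \<chi> \<Longrightarrow> \<chi> a = 0 \<longleftrightarrow> \<not> coprime a (int n)"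
  by (auto simp: dirichlet_character_def)

section \<open>Orthogonality and counting in a residue class\<close>

text \<open>Multiplication by \<open>c\<close>, reduced modulo \<open>n\<close>, permutes all
  residues congruent to 1 modulo \<open>d\<close>, units or not. The sum therefore equals
  \<open>\<chi> c\<close> times itself, and \<open>\<chi> c\<close> differs from 1.\<close>

lemma character_sum_residue_class_eq_0:
  assumes \<chi>: "dirichlet_character n \<chi>" and "n > 0" "d dvd n"
    and c: "coprime c (int n)" "[c = 1] (mod int d)" "\<chi> c \<noteq> 1"
  shows "(\<Sum>a | a \<in> {0..<int n} \<and> [a = 1] (mod int d). \<chi> a) = 0"
proof -
  let ?D = "{a. a \<in> {0..<int n} \<and> [a = 1] (mod int d)}"
  obtain c' where c': "[c * c' = 1] (mod int n)"
    using cong_solve_coprime_int[OF c(1)] by blast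
  have c'_d: "[c' = 1] (mod int d)"
  proof -
    have "[c * c' = 1] (mod int d)"
      using c' \<open>d dvd n\<close> by (meson cong_dvd_modulus int_dvd_int_iff)
    moreover have "[c * c' = 1 * c'] (mod int d)" using c(2) by (rule cong_mult) simp
    ultimately show ?thesis by (metis cong_sym cong_trans mult_1)
  qed
  have closed: "(e * a) mod int n \<in> ?D" if "[e = 1] (mod int d)" "a \<in> ?D" for e a
  proof -
    have "[e * a mod int n = e * a] (mod int d)"
      using \<open>d dvd n\<close> by (meson cong_dvd_modulus cong_mod_left cong_refl int_dvd_int_iff)
    moreover have "[e * a = 1 * 1] (mod int d)" using that by (intro cong_mult) auto
    ultimately show ?thesis using \<open>n > 0\<close> by (auto intro: cong_trans)
  qed
  have inverse: "e' * (e * a mod int n) mod int n = a"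
    if "[e * e' = 1] (mod int n)" "a \<in> ?D" for e e' a
  proof -
    have "[e' * (e * a mod int n) = e' * (e * a)] (mod int n)"
      by (intro cong_mult) auto
    also have "e' * (e * a) = (e * e') * a" by simp
    also have "[(e * e') * a = 1 * a] (mod int n)" using that by (intro cong_mult) auto
    finally show ?thesis using that by (simp add: cong_def)
  qed
  have "(\<Sum>a\<in>?D. \<chi> a) = (\<Sum>a\<in>?D. \<chi> (c * a))"
  proof (rule sum.reindex_bij_witness[where i = "\<lambda>a. c * a mod int n" and j = "\<lambda>a. c' * a mod int n"])
    fix a assume a: "a \<in> ?D"
    show "c * (c' * a mod int n) mod int n = a"
      using inverse[of c' c a] c' a by (simp add: mult.commute)
    show "c' * (c * a mod int n) mod int n = a"
      using inverse[of c c' a] c' a by simp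
    show "c' * a mod int n \<in> ?D" "c * a mod int n \<in> ?D"
      using closed a c'_d c(2) by blast+
    have "[c * (c' * a mod int n) = a] (mod int n)"
      using inverse[of c' c a] c' a by (simp add: mult.commute cong_def)
    then show "\<chi> (c * (c' * a mod int n)) = \<chi> a"
      by (rule dirichlet_character_cong[OF \<chi>])
  qed
  also have "\<dots> = \<chi> c * (\<Sum>a\<in>?D. \<chi> a)"
    by (simp add: dirichlet_character_mult[OF \<chi>] sum_distrib_left)
  finally show ?thesis using c(3) by simp
qed

text \<open>Serves twice: with \<open>c = 0\<close> for the sum over each \<open>b i\<close>, and
  with \<open>c = 1\<close> for a character that is trivial on the class.\<close>

lemma card_residue_class:
  assumes "n > 0" "d dvd n"
  shows "card {a. a \<in> {0..<int n} \<and> [a = c] (mod int d)} = n div d"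
proof -
  from assms obtain k where k: "n = d * k" by blast
  with \<open>n > 0\<close> have d: "d > 0" and "k > 0" by auto
  have "bij_betw (\<lambda>i. c mod int d + int d * i) {0..<int k}
          {a. a \<in> {0..<int n} \<and> [a = c] (mod int d)}"
  proof (rule bij_betwI[where g = "\<lambda>a. a div int d"])
    show "(\<lambda>i. c mod int d + int d * i) \<in> {0..<int k} \<rightarrow> {a. a \<in> {0..<int n} \<and> [a = c] (mod int d)}"
    proof
      fix i assume i: "i \<in> {0..<int k}"
      have "c mod int d + int d * i < int d + int d * i" using d by simp
      also have "\<dots> = int d * (i + 1)" by (simp add: algebra_simps)
      also have "\<dots> \<le> int d * int k" using i by (intro mult_left_mono) auto
      finally show "c mod int d + int d * i \<in> {a. a \<in> {0..<int n} \<and> [a = c] (mod int d)}"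
        using i d by (auto simp: k cong_def)
    qed
    show "(\<lambda>a. a div int d) \<in> {a. a \<in> {0..<int n} \<and> [a = c] (mod int d)} \<rightarrow> {0..<int k}"
    proof
      fix a assume a: "a \<in> {a. a \<in> {0..<int n} \<and> [a = c] (mod int d)}"
      have "int d * (a div int d) \<le> a"
        using mult_div_mod_eq[of "int d" a] pos_mod_sign[of "int d" a] d by linarith
      also have "a < int d * int k" using a by (simp add: k)
      finally have "a div int d < int k" using d by simp
      then show "a div int d \<in> {0..<int k}"
        using a d by (simp add: pos_imp_zdiv_nonneg_iff)
    qed
    show "c mod int d + int d * (a div int d) = a"
      if "a \<in> {a. a \<in> {0..<int n} \<and> [a = c] (mod int d)}" for a
      using that mod_mult_div_eq[of a "int d"] by (simp add: cong_def)
  qed (use d in simp)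
  from bij_betw_same_card[OF this] show ?thesis
    using d by (simp add: k)
qed

section \<open>Splitting the gcd sum over the divisors of n\<close>

text \<open>Gauss's identity: a positive integer is the sum of \<open>totient\<close> over its
  divisors. Writing the divisors of the gcd as those divisors of \<open>n\<close> that divide all of
  \<open>A\<close> makes the range of summation independent of \<open>A\<close>.\<close>

lemma Gcd_eq_sum_totient:
  assumes "n > 0"
  shows "Gcd (insert (int n) A) =
    (\<Sum>d | d dvd n. if \<forall>x\<in>A. int d dvd x then int (totient d) else 0)"
proof -
  define g where "g = nat (Gcd (insert (int n) A))"
  have g: "int g = Gcd (insert (int n) A)" by (simp add: g_def)
  have dvd_g: "d dvd g \<longleftrightarrow> d dvd n \<and> (\<forall>x\<in>A. int d dvd x)" for d
    unfolding int_dvd_int_iff[symmetric, of d g] g dvd_Gcd_iff by auto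
  have "int g = int (\<Sum>d | d dvd g. totient d)"
    by (simp add: totient_divisor_sum)
  also have "\<dots> = (\<Sum>d | d dvd n \<and> (\<forall>x\<in>A. int d dvd x). int (totient d))"
    by (simp add: dvd_g)
  also have "\<dots> = (\<Sum>d | d dvd n. if \<forall>x\<in>A. int d dvd x then int (totient d) else 0)"
    using assms by (simp flip: sum.inter_filter)
  finally show ?thesis using g by simp
qed

lemma residue_ring_carrier: "carrier (residue_ring (int n)) = {0..<int n}"
  by (auto simp: residue_ring_def)

lemma residue_ring_Units:
  assumes "n > 1"
  shows "Units (residue_ring (int n)) = {a \<in> {0..<int n}. coprime a (int n)}"
proof -
  interpret residues "int n" "residue_ring (int n)"
    using assms by unfold_locales auto
  \<comment> \<open>The description of the units in the locale starts at 1, while the interval here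
    starts at 0; as \<open>n > 1\<close>, the residue 0 is not coprime to \<open>n\<close>.\<close>
  have "a \<noteq> 0" if "coprime a (int n)" for a using that assms by auto
  then show ?thesis unfolding res_units_eq by force
qed

lemma gcd_character_sum:
  fixes \<chi> :: "nat \<Rightarrow> int \<Rightarrow> complex"
  assumes "n > 1" and \<chi>: "\<And>i. i \<in> {1..s} \<Longrightarrow> dirichlet_character n (\<chi> i)"
  shows "(\<Sum>a \<in> {1..s} \<rightarrow>\<^sub>E Units (residue_ring (int n)).
           \<Sum>b \<in> {1..r} \<rightarrow>\<^sub>E carrier (residue_ring (int n)).
             of_int (Gcd ((\<lambda>i. a i - 1) ` {1..s} \<union> b ` {1..r} \<union> {int n})) *
             (\<Prod>i = 1..s. \<chi> i (a i))) =
         (\<Sum>d | d dvd n. of_nat (totient d) *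
           (\<Prod>i = 1..s. \<Sum>a | a \<in> {0..<int n} \<and> [a = 1] (mod int d). \<chi> i a) *
           of_nat (n div d) ^ r)" (is "?lhs = _")
proof -
  let ?U = "Units (residue_ring (int n))" and ?Z = "{0..<int n}"
  \<comment> \<open>Indicators of \<open>d\<close> dividing \<open>x - 1\<close> and
    \<open>x\<close>. With them the condition that \<open>d\<close> divides all entries becomes a
    product over the coordinates.\<close>
  define A where "A d x = (if [x = 1] (mod int d) then 1 else 0 :: complex)" for d x
  define B where "B d x = (if [x = 0] (mod int d) then 1 else 0 :: complex)" for d x
  have finU: "finite ?U"
    unfolding residue_ring_Units[OF \<open>n > 1\<close>] by (rule finite_Collect_conjI) simp
  have prod_if: "(\<Prod>i=1..k. if P i then 1 else 0 :: complex) = (if \<forall>i\<in>{1..k}. P i then 1 else 0)"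
    for k and P :: "nat \<Rightarrow> bool" by auto
  have gcd_eq: "of_int (Gcd ((\<lambda>i. a i - 1) ` {1..s} \<union> b ` {1..r} \<union> {int n})) =
      (\<Sum>d | d dvd n. of_nat (totient d) * (\<Prod>i=1..s. A d (a i)) * (\<Prod>i=1..r. B d (b i)))" for a b
  proof -
    have "(\<lambda>i. a i - 1) ` {1..s} \<union> b ` {1..r} \<union> {int n} =
        insert (int n) ((\<lambda>i. a i - 1) ` {1..s} \<union> b ` {1..r})" by auto
    then have "Gcd ((\<lambda>i. a i - 1) ` {1..s} \<union> b ` {1..r} \<union> {int n}) =
        (\<Sum>d | d dvd n. if \<forall>x \<in> (\<lambda>i. a i - 1) ` {1..s} \<union> b ` {1..r}. int d dvd x
          then int (totient d) else 0)"
      using assms by (simp only: Gcd_eq_sum_totient)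
    then show ?thesis
      unfolding A_def B_def prod_if of_int_sum
      by (auto simp: cong_iff_dvd_diff intro!: sum.cong)
  qed
  have A_sum: "(\<Sum>a\<in>?U. A d a * \<chi> i a) = (\<Sum>a | a \<in> ?Z \<and> [a = 1] (mod int d). \<chi> i a)"
    if "i \<in> {1..s}" for d i
  proof -
    \<comment> \<open>The added residues are non-units, where the character vanishes.\<close>
    have "(\<Sum>a\<in>?U. A d a * \<chi> i a) = (\<Sum>a\<in>?Z. A d a * \<chi> i a)"
      using dirichlet_character_eq_0_iff[OF \<chi>[OF that]] assms
      by (intro sum.mono_neutral_left) (auto simp: residue_ring_Units)
    also have "\<dots> = (\<Sum>a\<in>?Z. if [a = 1] (mod int d) then \<chi> i a else 0)"
      by (intro sum.cong) (auto simp: A_def)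
    finally show ?thesis by (simp flip: sum.inter_filter)
  qed
  have B_sum: "(\<Sum>b\<in>?Z. B d b) = of_nat (n div d)" if "d dvd n" for d
  proof -
    have "(\<Sum>b\<in>?Z. B d b) = of_nat (card {b. b \<in> ?Z \<and> [b = 0] (mod int d)})"
      by (simp add: B_def flip: sum.inter_filter)
    with that assms show ?thesis by (simp only: card_residue_class)
  qed
  have "?lhs = (\<Sum>a \<in> {1..s} \<rightarrow>\<^sub>E ?U. \<Sum>b \<in> {1..r} \<rightarrow>\<^sub>E ?Z. \<Sum>d | d dvd n.
      of_nat (totient d) * (\<Prod>i=1..s. A d (a i) * \<chi> i (a i)) * (\<Prod>i=1..r. B d (b i)))"
    unfolding gcd_eq residue_ring_carrier prod.distrib sum_distrib_right
    by (simp only: ac_simps)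
  also have "\<dots> = (\<Sum>d | d dvd n. \<Sum>a \<in> {1..s} \<rightarrow>\<^sub>E ?U. \<Sum>b \<in> {1..r} \<rightarrow>\<^sub>E ?Z.
      of_nat (totient d) * (\<Prod>i=1..s. A d (a i) * \<chi> i (a i)) * (\<Prod>i=1..r. B d (b i)))"
    by (simp only: sum.swap[of _ "{d. d dvd n}"])
  also have "\<dots> = (\<Sum>d | d dvd n. of_nat (totient d) *
      (\<Sum>a \<in> {1..s} \<rightarrow>\<^sub>E ?U. \<Prod>i=1..s. A d (a i) * \<chi> i (a i)) *
      (\<Sum>b \<in> {1..r} \<rightarrow>\<^sub>E ?Z. \<Prod>i=1..r. B d (b i)))"
    by (simp only: mult.assoc sum_product, simp only: sum_distrib_left)
  \<comment> \<open>For fixed \<open>d\<close> the coordinates are independent, so a sum of products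
    over tuples is a product of sums.\<close>
  also have "\<dots> = (\<Sum>d | d dvd n. of_nat (totient d) *
      (\<Prod>i=1..s. \<Sum>a\<in>?U. A d a * \<chi> i a) * (\<Prod>i=1..r. \<Sum>b\<in>?Z. B d b))"
    by (simp only: prod_sum_PiE finU finite_atLeastAtMost finite_atLeastLessThan_int)
  also have "\<dots> = (\<Sum>d | d dvd n. of_nat (totient d) *
      (\<Prod>i = 1..s. \<Sum>a | a \<in> ?Z \<and> [a = 1] (mod int d). \<chi> i a) * of_nat (n div d) ^ r)"
    by (intro sum.cong) (simp_all add: A_sum B_sum)
  finally show ?thesis .
qed

section \<open>Conductors and triviality on residue classes\<close>

lemma conductor_inducing_character:
  assumes "dirichlet_character n \<chi>"
  obtains \<psi> where "dirichlet_character (conductor n \<chi>) \<psi>"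
    "\<And>a. coprime a (int n) \<Longrightarrow> \<chi> a = \<psi> a"
proof -
  let ?P = "\<lambda>d. d dvd n \<and>
    (\<exists>\<psi>. dirichlet_character d \<psi> \<and> (\<forall>a. coprime a (int n) \<longrightarrow> \<chi> a = \<psi> a))"
  \<comment> \<open>The modulus \<open>n\<close> is a candidate, with the character inducing itself,
    so the least candidate exists.\<close>
  have "?P n" using assms by (intro conjI exI[of _ \<chi>]) auto
  then have "?P (conductor n \<chi>)" unfolding conductor_def by (rule LeastI)
  then show thesis using that by metis
qed

lemma conductor_dvd_imp_trivial_on_residue_class:
  assumes "dirichlet_character n \<chi>" "conductor n \<chi> dvd d"
    and "coprime c (int n)" "[c = 1] (mod int d)"
  shows "\<chi> c = 1"
proof -
  obtain \<psi> where \<psi>: "dirichlet_character (conductor n \<chi>) \<psi>"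
    "\<And>a. coprime a (int n) \<Longrightarrow> \<chi> a = \<psi> a"
    using conductor_inducing_character[OF assms(1)] by metis
  have "[c = 1] (mod int (conductor n \<chi>))"
    using assms(2,4) by (meson cong_dvd_modulus int_dvd_int_iff)
  with \<psi> assms(3) show ?thesis
    using dirichlet_character_cong dirichlet_character_1 by metis
qed

text \<open>For \<open>j > 0\<close> the moduli \<open>p ^ j\<close> and \<open>p ^ m\<close> have
  the same coprime integers, and triviality on the class of 1 makes \<open>\<chi>\<close> periodic
  modulo \<open>p ^ j\<close>. So \<open>\<chi>\<close> is itself a character modulo
  \<open>p ^ j\<close>, and \<open>p ^ j\<close> is a candidate for the conductor.\<close>

lemma trivial_on_residue_class_imp_conductor_le:
  assumes "j \<le> m" and \<chi>: "dirichlet_character (p ^ m) \<chi>"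
    and trivial: "\<And>c. coprime c (int (p ^ m)) \<Longrightarrow> [c = 1] (mod int (p ^ j)) \<Longrightarrow> \<chi> c = 1"
  shows "conductor (p ^ m) \<chi> \<le> p ^ j"
proof -
  have "\<exists>\<psi>. dirichlet_character (p ^ j) \<psi> \<and> (\<forall>a. coprime a (int (p ^ m)) \<longrightarrow> \<chi> a = \<psi> a)"
  proof (cases "j = 0")
    case True
    \<comment> \<open>A character modulo 1 vanishes nowhere, so the inducing character is the
      constant 1 rather than \<open>\<chi>\<close>.\<close>
    then have "dirichlet_character (p ^ j) (\<lambda>_. 1)" by (simp add: dirichlet_character_def)
    with True trivial show ?thesis by (intro exI[of _ "\<lambda>_. 1"]) auto
  next
    case False
    have cop: "coprime a (int (p ^ j)) \<longleftrightarrow> coprime a (int (p ^ m))" for a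
      using False \<open>j \<le> m\<close> by simp
    have "\<chi> (a + int (p ^ j)) = \<chi> a" for a
    proof (cases "coprime a (int (p ^ m))")
      case True
      then obtain b where b: "[a * b = 1] (mod int (p ^ m))"
        using cong_solve_coprime_int by blast
      \<comment> \<open>With \<open>b\<close> inverse to \<open>a\<close>, the shift by
        \<open>p ^ j\<close> becomes multiplication by a unit congruent to 1 modulo
        \<open>p ^ j\<close>, where \<open>\<chi>\<close> is 1.\<close>
      have "[a * (1 + b * int (p ^ j)) = a + int (p ^ j)] (mod int (p ^ m))"
        using cong_add[OF cong_refl cong_mult[OF b cong_refl], of a "int (p ^ j)"]
        by (simp add: algebra_simps)
      then have "\<chi> (a + int (p ^ j)) = \<chi> a * \<chi> (1 + b * int (p ^ j))"
        using dirichlet_character_cong[OF \<chi>] dirichlet_character_mult[OF \<chi>] by metis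
      moreover have "\<chi> (1 + b * int (p ^ j)) = 1"
      proof (rule trivial)
        show one: "[1 + b * int (p ^ j) = 1] (mod int (p ^ j))"
          by (simp add: cong_iff_dvd_diff)
        show "coprime (1 + b * int (p ^ j)) (int (p ^ m))"
          using cong_imp_coprime[OF cong_sym[OF one]] cop by simp
      qed
      ultimately show ?thesis by simp
    next
      case False
      have "[a = a + int (p ^ j)] (mod int (p ^ j))" by (simp add: cong_iff_dvd_diff)
      then have "\<not> coprime (a + int (p ^ j)) (int (p ^ m))"
        using False cop cong_imp_coprime cong_sym by blast
      with False show ?thesis using dirichlet_character_eq_0_iff[OF \<chi>] by metis
    qed
    then have "dirichlet_character (p ^ j) \<chi>"
      using \<chi> cop unfolding dirichlet_character_def by blast
    then show ?thesis by blast
  qed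
  then show ?thesis
    unfolding conductor_def using \<open>j \<le> m\<close> by (intro Least_le) (auto intro: le_imp_power_dvd)
qed

section \<open>Character sums and divisor sums for prime powers\<close>

text \<open>If \<open>j < t\<close>, the conductor exceeds \<open>p ^ j\<close>, so some unit in the
  class has character value different from 1 and the sum vanishes. Otherwise the character is 1 on
  all units of the class, and the sum counts them.\<close>

lemma character_sum_residue_class_prime_power:
  assumes "prime p" "m \<ge> 1" "j \<le> m" and \<chi>: "dirichlet_character (p ^ m) \<chi>"
    and t: "conductor (p ^ m) \<chi> = p ^ t"
  shows "(\<Sum>a | a \<in> {0..<int (p ^ m)} \<and> [a = 1] (mod int (p ^ j)). \<chi> a) =
    (if j < t then 0 else if j = 0 then of_nat (totient (p ^ m)) else of_nat (p ^ (m - j)))"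
    (is "sum \<chi> ?D = _")
proof (cases "j < t")
  case True
  have "p > 1" using \<open>prime p\<close> by (rule prime_gt_1_nat)
  then have "\<not> conductor (p ^ m) \<chi> \<le> p ^ j" using t True by simp
  then obtain c where c: "coprime c (int (p ^ m))" "[c = 1] (mod int (p ^ j))" "\<chi> c \<noteq> 1"
    using trivial_on_residue_class_imp_conductor_le[OF \<open>j \<le> m\<close> \<chi>] by blast
  have "sum \<chi> ?D = 0"
    by (rule character_sum_residue_class_eq_0[OF \<chi> _ _ c])
      (use \<open>p > 1\<close> \<open>j \<le> m\<close> in \<open>auto simp: le_imp_power_dvd\<close>)
  with True show ?thesis by simp
next
  case False
  have "p > 1" using \<open>prime p\<close> by (rule prime_gt_1_nat)
  have fin: "finite ?D" by (rule finite_subset[of _ "{0..<int (p ^ m)}"]) auto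
  let ?C = "{a \<in> ?D. coprime a (int (p ^ m))}"
  have "sum \<chi> ?D = sum \<chi> ?C"
    using fin dirichlet_character_eq_0_iff[OF \<chi>] by (intro sum.mono_neutral_right) auto
  also have "\<dots> = sum (\<lambda>_. 1) ?C"
    using conductor_dvd_imp_trivial_on_residue_class[OF \<chi>, of "p ^ j"] t False
    by (intro sum.cong) (auto simp: le_imp_power_dvd)
  also have "\<dots> = of_nat (card ?C)" by simp
  also have "card ?C = (if j = 0 then totient (p ^ m) else p ^ (m - j))"
  proof (cases "j = 0")
    case True
    interpret residues "int (p ^ m)" "residue_ring (int (p ^ m))"
      using one_less_power[OF \<open>p > 1\<close>, of m] \<open>m \<ge> 1\<close> by unfold_locales (simp flip: of_nat_power)
    have "?C = Units (residue_ring (int (p ^ m)))"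
      using True residue_ring_Units[of "p ^ m"] m_gt_one by auto
    then show ?thesis using True totient_eq by (simp del: of_nat_power)
  next
    case j: False
    \<comment> \<open>For \<open>j > 0\<close>, being congruent to 1 modulo \<open>p ^ j\<close>
      already forces coprimality to \<open>p\<close>, so every element of the class is
      counted.\<close>
    have "coprime a (int (p ^ m))" if "a \<in> ?D" for a
    proof -
      have "[1 = a] (mod int (p ^ j))" using that by (simp add: cong_sym_eq)
      then have "coprime a (int (p ^ j))" by (rule cong_imp_coprime) simp
      with j show ?thesis by simp
    qed
    then have "?C = ?D" by blast
    then show ?thesis
      using card_residue_class[of "p ^ m" "p ^ j" 1] j \<open>j \<le> m\<close> \<open>p > 1\<close>
      by (simp add: le_imp_power_dvd power_diff)
  qed
  finally show ?thesis using False by simp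
qed

lemma bij_betw_prime_power_divisors:
  assumes "prime (p::nat)"
  shows "bij_betw (\<lambda>j. p ^ j) {..m} {d. d dvd p ^ m}"
  unfolding bij_betw_def
proof
  show "inj_on (\<lambda>j. p ^ j) {..m}"
    using prime_gt_1_nat[OF assms] by (auto simp: inj_on_def)
  show "(\<lambda>j. p ^ j) ` {..m} = {d. d dvd p ^ m}"
    unfolding divides_primepow_nat[OF assms] by blast
qed

lemma divisor_sigma_prime_power:
  assumes "prime p"
  shows "divisor_sigma k (p ^ m) = (\<Sum>j\<le>m. p ^ (j * k))"
  unfolding divisor_sigma_def
  using sum.reindex_bij_betw[OF bij_betw_prime_power_divisors[OF assms], of "\<lambda>e. e ^ k" m]
  by (simp add: power_mult)

section \<open>Evaluation of the sum\<close>

theorem theorem2p5: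
  fixes r s p m n u :: nat
    and t :: "nat \<Rightarrow> nat"
    and \<chi> :: "nat \<Rightarrow> int \<Rightarrow> complex"
    and S :: complex
  assumes "s > 0"
    and "prime p" and "m \<ge> 1" and "n = p ^ m"
    and "\<And>i. i \<in> {1..s} \<Longrightarrow> dirichlet_character n (\<chi> i)"
    and "\<And>i. i \<in> {1..s} \<Longrightarrow> t i \<le> m \<and> conductor n (\<chi> i) = p ^ t i"
    and "u = Max (t ` {1..s})"
    and "S = (\<Sum>a \<in> {1..s} \<rightarrow>\<^sub>E Units (residue_ring (int n)).
              \<Sum>b \<in> {1..r} \<rightarrow>\<^sub>E carrier (residue_ring (int n)).
                of_int (Gcd ((\<lambda>i. a i - 1) ` {1..s} \<union> b ` {1..r} \<union> {int n})) *
                (\<Prod>i = 1..s. \<chi> i (a i)))"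
  shows "(u > 0 \<longrightarrow>
            S = of_nat (totient (p ^ m)) * of_nat (divisor_sigma (s + r - 1) (p ^ (m - u)))) \<and>
         (u = 0 \<longrightarrow>
            S = of_nat (totient (p ^ m)) *
                (of_nat (totient (p ^ m)) ^ (s - 1) * of_nat p ^ (m * r)
                 + of_nat (divisor_sigma (s + r - 1) (p ^ m))
                 - of_nat p ^ (m * (s + r - 1))))"
proof -
  have p: "p > 1" using \<open>prime p\<close> by (rule prime_gt_1_nat)
  then have "n > 1" using \<open>m \<ge> 1\<close> \<open>n = p ^ m\<close> by (auto intro: one_less_power simp del: One_nat_def)
  \<comment> \<open>\<open>s > 0\<close> makes the set under \<open>Max\<close> nonempty.\<close>
  have u: "u \<le> j \<longleftrightarrow> (\<forall>i\<in>{1..s}. t i \<le> j)" for j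
    using \<open>s > 0\<close> unfolding assms(7) by (subst Max_le_iff) auto
  have "u \<le> m" using u assms(6) by blast
  let ?\<phi> = "of_nat (totient (p ^ m)) :: complex"
  define k where "k = s + r - 1"
  \<comment> \<open>\<open>c j\<close> is the common value of the nonvanishing character sums at
    level \<open>j\<close>, and \<open>T j\<close> is the contribution of the divisor
    \<open>p ^ j\<close> when \<open>u \<le> j\<close>.\<close>
  define c where "c j = (if j = 0 then ?\<phi> else of_nat (p ^ (m - j)))" for j
  define T where "T j = of_nat (totient (p ^ j)) * c j ^ s * of_nat (p ^ (m - j)) ^ r" for j
  have prod_eq: "(\<Prod>i = 1..s. \<Sum>a | a \<in> {0..<int n} \<and> [a = 1] (mod int (p ^ j)). \<chi> i a) =
      (if u \<le> j then c j ^ s else 0)" if "j \<le> m" for j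
  proof -
    have "(\<Prod>i = 1..s. \<Sum>a | a \<in> {0..<int n} \<and> [a = 1] (mod int (p ^ j)). \<chi> i a) =
        (\<Prod>i = 1..s. if j < t i then 0 else c j)"
      using character_sum_residue_class_prime_power[OF assms(2,3) that] assms(4-6)
      by (intro prod.cong) (simp_all add: c_def)
    also have "\<dots> = (if u \<le> j then c j ^ s else 0)"
    proof (cases "u \<le> j")
      case True
      then have "\<forall>i\<in>{1..s}. \<not> j < t i" using u by (simp add: not_less)
      then have "(\<Prod>i = 1..s. if j < t i then 0 else c j) = (\<Prod>i = 1..s. c j)"
        by (intro prod.cong) auto
      with True show ?thesis by simp
    qed (use u in \<open>auto simp: not_le\<close>)
    finally show ?thesis .
  qed
  have "S = (\<Sum>d | d dvd n. of_nat (totient d) *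
      (\<Prod>i = 1..s. \<Sum>a | a \<in> {0..<int n} \<and> [a = 1] (mod int d). \<chi> i a) * of_nat (n div d) ^ r)"
    unfolding assms(8) using \<open>n > 1\<close> assms(5) by (rule gcd_character_sum)
  also have "\<dots> = (\<Sum>j\<le>m. of_nat (totient (p ^ j)) *
      (\<Prod>i = 1..s. \<Sum>a | a \<in> {0..<int n} \<and> [a = 1] (mod int (p ^ j)). \<chi> i a) *
      of_nat (n div p ^ j) ^ r)"
    unfolding \<open>n = p ^ m\<close>
    by (rule sum.reindex_bij_betw[OF bij_betw_prime_power_divisors[OF \<open>prime p\<close>], symmetric])
  also have "\<dots> = (\<Sum>j\<le>m. if u \<le> j then T j else 0)"
  proof (intro sum.cong refl)
    fix j assume "j \<in> {..m}"
    then have "j \<le> m" and "n div p ^ j = p ^ (m - j)"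
      using p by (simp_all add: \<open>n = p ^ m\<close> power_diff)
    then show "of_nat (totient (p ^ j)) *
        (\<Prod>i = 1..s. \<Sum>a | a \<in> {0..<int n} \<and> [a = 1] (mod int (p ^ j)). \<chi> i a) *
        of_nat (n div p ^ j) ^ r = (if u \<le> j then T j else 0)"
      by (simp only: prod_eq) (simp add: T_def)
  qed
  also have "\<dots> = (\<Sum>j\<in>{u..m}. T j)"
    by (subst sum.inter_filter[symmetric]) (auto intro: sum.cong)
  finally have S: "S = (\<Sum>j\<in>{u..m}. T j)" .
  have T: "T j = ?\<phi> * of_nat (p ^ ((m - j) * k))" if "j > 0" "j \<le> m" for j
  proof -
    \<comment> \<open>One of the \<open>s + r = k + 1\<close> factors \<open>p ^ (m - j)\<close> is
      absorbed here, leaving exponent \<open>k\<close>. The identity requires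
      \<open>j > 0\<close>.\<close>
    have tot: "totient (p ^ j) * p ^ (m - j) = totient (p ^ m)"
      using that \<open>prime p\<close> by (simp add: totient_prime_power flip: power_add)
    have "s + r = Suc k" using \<open>s > 0\<close> by (simp add: k_def)
    then have "totient (p ^ j) * (p ^ (m - j)) ^ s * (p ^ (m - j)) ^ r =
        totient (p ^ j) * (p ^ (m - j)) ^ Suc k"
      by (metis mult.assoc power_add)
    also have "\<dots> = totient (p ^ m) * p ^ ((m - j) * k)"
      by (simp flip: tot add: power_mult)
    finally have "of_nat (totient (p ^ j) * (p ^ (m - j)) ^ s * (p ^ (m - j)) ^ r) =
        (of_nat (totient (p ^ m) * p ^ ((m - j) * k)) :: complex)" by (rule arg_cong)
    with that show ?thesis by (simp add: T_def c_def)
  qed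
  have sum_T: "(\<Sum>j\<in>{v..m}. T j) = ?\<phi> * of_nat (divisor_sigma k (p ^ (m - v)))"
    if "v > 0" "v \<le> m" for v
  proof -
    have "(\<Sum>j\<in>{v..m}. T j) = (\<Sum>j\<in>{v..m}. ?\<phi> * of_nat (p ^ ((m - j) * k)))"
      using that T by (intro sum.cong) auto
    \<comment> \<open>Passing to the complementary exponent \<open>i = m - j\<close> yields the
      divisors of \<open>p ^ (m - v)\<close>.\<close>
    also have "\<dots> = (\<Sum>i\<le>m - v. ?\<phi> * of_nat (p ^ (i * k)))"
      using that by (intro sum.reindex_bij_witness[where i = "\<lambda>i. m - i" and j = "\<lambda>j. m - j"]) auto
    finally show ?thesis
      by (simp add: divisor_sigma_prime_power[OF \<open>prime p\<close>] sum_distrib_left)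
  qed
  show ?thesis
  proof (intro conjI impI)
    assume "u > 0"
    then show "S = ?\<phi> * of_nat (divisor_sigma (s + r - 1) (p ^ (m - u)))"
      using sum_T[of u] \<open>u \<le> m\<close> by (simp add: S k_def)
  next
    assume "u = 0"
    \<comment> \<open>The divisor 1 is split off, since there each character sum is
      \<open>totient (p ^ m)\<close> instead of \<open>p ^ m\<close>.\<close>
    then have "S = T 0 + (\<Sum>j\<in>{1..m}. T j)"
      by (simp add: S sum.atLeast_Suc_atMost)
    also have "T 0 = ?\<phi> * (?\<phi> ^ (s - 1) * of_nat p ^ (m * r))"
      using \<open>s > 0\<close> by (simp add: T_def c_def power_mult flip: power_Suc)
    also have "(\<Sum>j\<in>{1..m}. T j) = ?\<phi> * of_nat (divisor_sigma k (p ^ (m - 1)))"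
      using \<open>m \<ge> 1\<close> by (intro sum_T) auto
    \<comment> \<open>Passing from \<open>p ^ m\<close> to \<open>p ^ (m - 1)\<close> loses only the
      top divisor, whose term is \<open>p ^ (m * k)\<close>.\<close>
    also have "of_nat (divisor_sigma k (p ^ (m - 1))) =
        of_nat (divisor_sigma k (p ^ m)) - (of_nat p ^ (m * k) :: complex)"
      unfolding divisor_sigma_prime_power[OF \<open>prime p\<close>]
      using \<open>m \<ge> 1\<close> by (cases m) simp_all
    finally show "S = ?\<phi> * (?\<phi> ^ (s - 1) * of_nat p ^ (m * r)
        + of_nat (divisor_sigma (s + r - 1) (p ^ m)) - of_nat p ^ (m * (s + r - 1)))"
      by (simp add: k_def algebra_simps)
  qed
qed

end
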